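(* Let $P=(\varphi_n)_{n=0}^\infty$ be a fixed sequence of functions as in the context. Let $x_0\in(0,1]$ be the supremum of some $P$-cylinder, and let $(x_n)_{n=1}^\infty$ be a sequence of real numbers such that $0<x_n<x_0$ for all $n\in\mathbb{N}$. For each $n\in\mathbb{N}$ let $k_n$ be the minimum number $j\in\mathbb{N}$ such that $p_j(x_n)\neq p_j(x_0)$. Then $$\lim_{n\to\infty}x_n=x_0\iff\lim_{n\to\infty}k_n=\infty.$$
   Context: $\mathbb{N}=\{1,2,3,\ldots\}$. Fix a sequence $P=(\varphi_n)_{n=0}^\infty$, where $\varphi_0\in\mathbb{N}$ is a constant and, for $n\ge 1$, $\varphi_n\colon\mathbb{N}^n\to\mathbb{N}$ is an arbitrary function. The $P$-representation (positive Perron expansion) of $x\in(0,1]$ is the expansion $$x=\sum_{n=0}^{\infty}\frac{r_0 r_1\cdots r_n}{(p_1-1)p_1\cdots(p_n-1)p_n\,p_{n+1}},$$ where $p_1,p_2,\ldots\in\mathbb{N}$, $r_0=\varphi_0$, $r_n=\varphi_n(p_1,\ldots,p_n)$ and $p_n\ge r_{n-1}+1$ for all $n\in\mathbb{N}$ (the $n=0$ term is $r_0/p_1$). It is known that for every such $P$ each $x\in(0,1]$ has a unique $P$-representation; the number $p_n=p_n(x)$ is called the $n$th $P$-digit of $x$. For $k\ge 1$, the $P$-cylinder of rank $k$ with base $c_1\ldots c_k$ is the set $\Delta^P_{c_1\ldots c_k}$ of all $x\in(0,1]$ with $p_1(x)=c_1,\ldots,p_k(x)=c_k$; here the base is admissible,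 i.e. $c_1\ge\varphi_0+1$ and $c_i\ge\varphi_{i-1}(c_1,\ldots,c_{i-1})+1$ for $2\le i\le k$, so that the cylinder is nonempty. It is known that each $P$-cylinder is a half-open interval of the form $(a,b]$. *)

theory Defs
  imports Complex_Main
begin

text \<open>
  The sequence \<open>P = (\<phi>\<^sub>n)\<close> is a function \<open>\<phi> :: nat \<Rightarrow> nat list \<Rightarrow> nat\<close>; only the values of \<open>\<phi> n\<close>
  at lists of length \<open>n\<close> with positive entries are meaningful, and those must be positive.
\<close>

definition perron_functions :: "(nat \<Rightarrow> nat list \<Rightarrow> nat) \<Rightarrow> bool" where
  "perron_functions \<phi> \<longleftrightarrow>
     (\<forall>n c. length c = n \<and> (\<forall>d\<in>set c. 1 \<le> d) \<longrightarrow> 1 \<le> \<phi> n c)"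

text \<open>
  Digit sequences \<open>p :: nat \<Rightarrow> nat\<close> are indexed from 1; the value \<open>p 0\<close> is never used. Thus
  \<open>map p [1..<Suc n]\<close> is the tuple \<open>(p\<^sub>1, \<dots>, p\<^sub>n)\<close>.
\<close>

definition perron_r :: "(nat \<Rightarrow> nat list \<Rightarrow> nat) \<Rightarrow> (nat \<Rightarrow> nat) \<Rightarrow> nat \<Rightarrow> nat" where
  "perron_r \<phi> p n = \<phi> n (map p [1..<Suc n])"

definition is_P_representation :: "(nat \<Rightarrow> nat list \<Rightarrow> nat) \<Rightarrow> real \<Rightarrow> (nat \<Rightarrow> nat) \<Rightarrow> bool" where
  "is_P_representation \<phi> x p \<longleftrightarrow>
     (\<forall>n\<ge>1. p n \<ge> perron_r \<phi> p (n - 1) + 1) \<and>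
     (\<lambda>n. (\<Prod>i=0..n. real (perron_r \<phi> p i)) /
           ((\<Prod>i=1..n. (real (p i) - 1) * real (p i)) * real (p (n + 1)))) sums x"

text \<open>
  Since \<open>p 0\<close> is unconstrained, uniqueness of the representation means uniqueness of each
  \<open>p n\<close> with \<open>n \<ge> 1\<close>; hence the description operator is applied to the single digit.
  The result is meaningful for \<open>0 < x \<le> 1\<close> and \<open>n \<ge> 1\<close>.
\<close>

definition P_digit :: "(nat \<Rightarrow> nat list \<Rightarrow> nat) \<Rightarrow> real \<Rightarrow> nat \<Rightarrow> nat" where
  "P_digit \<phi> x n = (THE d. \<exists>p. is_P_representation \<phi> x p \<and> p n = d)"

text \<open>Bases \<open>c\<^sub>1 \<dots> c\<^sub>k\<close> are lists, so that \<open>c\<^sub>i\<close> is \<open>c ! (i - 1)\<close>.\<close>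

definition admissible_base :: "(nat \<Rightarrow> nat list \<Rightarrow> nat) \<Rightarrow> nat list \<Rightarrow> bool" where
  "admissible_base \<phi> c \<longleftrightarrow>
     1 \<le> length c \<and> (\<forall>i\<in>{1..length c}. c ! (i - 1) \<ge> \<phi> (i - 1) (take (i - 1) c) + 1)"

definition P_cylinder :: "(nat \<Rightarrow> nat list \<Rightarrow> nat) \<Rightarrow> nat list \<Rightarrow> real set" where
  "P_cylinder \<phi> c =
     {x. 0 < x \<and> x \<le> 1 \<and> (\<forall>i\<in>{1..length c}. P_digit \<phi> x i = c ! (i - 1))}"

end

theory Submission
  imports Defs
begin

text \<open>
  Write \<open>S\<^sub>n\<close> for the \<open>n\<close>th partial sum of a \<open>P\<close>-representation of \<open>x\<close> and \<open>W\<^sub>n\<close> for the product of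
  the factors \<open>r\<^sub>i\<^sub>-\<^sub>1 / ((p\<^sub>i - 1) p\<^sub>i)\<close> with \<open>i \<le> n\<close>. Everything rests on the enclosure
  \<open>S\<^sub>n < x \<le> S\<^sub>n + W\<^sub>n\<close>. The left inequality holds because all terms are positive. The right one
  holds because \<open>1 / p + 1 / ((p - 1) p) = 1 / (p - 1)\<close> gives
  \<open>S\<^sub>n\<^sub>+\<^sub>1 + W\<^sub>n\<^sub>+\<^sub>1 = S\<^sub>n + W\<^sub>n r\<^sub>n / (p\<^sub>n\<^sub>+\<^sub>1 - 1)\<close>, so that the constraint \<open>p\<^sub>n\<^sub>+\<^sub>1 \<ge> r\<^sub>n + 1\<close> makes
  \<open>S\<^sub>n + W\<^sub>n\<close> decrease. The same constraint makes every digit at least \<open>2\<close> and yields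
  \<open>W\<^sub>n \<le> 2\<^sup>-\<^sup>n\<close>. Hence, for digits that obey the constraint, the enclosure for all \<open>n\<close> is equivalent
  to being a representation (\<open>is_P_representation_iff_enclosed\<close>).

  Two consequences carry the proof. The enclosure orders the expansions: if two of them first
  differ at place \<open>j\<close>, then the number with the larger digit is at most \<open>S\<^sub>j\<close> of the other one
  (\<open>larger_digit_le_partial_sum\<close>), which also gives uniqueness of the digits. Existence comes from
  choosing the digits greedily, each being forced by the enclosure.

  If now \<open>x\<^sub>n\<close> shares its first \<open>m\<close> digits with \<open>x\<^sub>0\<close>, both lie in an interval of length \<open>W\<^sub>m\<close>, so
  \<open>k\<^sub>n \<rightarrow> \<infinity>\<close> forces \<open>x\<^sub>n \<rightarrow> x\<^sub>0\<close>. Conversely \<open>S\<^sub>m(x\<^sub>0) < x\<^sub>0\<close> strictly, so the \<open>x\<^sub>n\<close>, which approach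
  from the left, eventually satisfy \<open>S\<^sub>m(x\<^sub>0) < x\<^sub>n < x\<^sub>0\<close>, and the ordering then forces agreement
  of the first \<open>m\<close> digits.
\<close>

section \<open>Partial sums and weights of a digit sequence\<close>

definition admissible_digits :: "(nat \<Rightarrow> nat list \<Rightarrow> nat) \<Rightarrow> (nat \<Rightarrow> nat) \<Rightarrow> bool" where
  "admissible_digits \<phi> p \<longleftrightarrow> (\<forall>n\<ge>1. p n \<ge> perron_r \<phi> p (n - 1) + 1)"

definition perron_term :: "(nat \<Rightarrow> nat list \<Rightarrow> nat) \<Rightarrow> (nat \<Rightarrow> nat) \<Rightarrow> nat \<Rightarrow> real" where
  "perron_term \<phi> p n = (\<Prod>i=0..n. real (perron_r \<phi> p i)) /
     ((\<Prod>i=1..n. (real (p i) - 1) * real (p i)) * real (p (n + 1)))"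

definition partial_sum :: "(nat \<Rightarrow> nat list \<Rightarrow> nat) \<Rightarrow> (nat \<Rightarrow> nat) \<Rightarrow> nat \<Rightarrow> real" where
  "partial_sum \<phi> p n = (\<Sum>i<n. perron_term \<phi> p i)"

definition weight :: "(nat \<Rightarrow> nat list \<Rightarrow> nat) \<Rightarrow> (nat \<Rightarrow> nat) \<Rightarrow> nat \<Rightarrow> real" where
  "weight \<phi> p n = (\<Prod>i<n. real (perron_r \<phi> p i)) / (\<Prod>i=1..n. (real (p i) - 1) * real (p i))"

lemma is_P_representation_iff:
  "is_P_representation \<phi> x p \<longleftrightarrow> admissible_digits \<phi> p \<and> perron_term \<phi> p sums x"
  unfolding is_P_representation_def admissible_digits_def perron_term_def ..

lemma perron_term_eq_weight:
  "perron_term \<phi> p n = weight \<phi> p n * real (perron_r \<phi> p n) / real (p (Suc n))"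
  by (simp add: perron_term_def weight_def atLeast0AtMost 
      flip: lessThan_Suc_atMost)

lemma partial_sum_0 [simp]: "partial_sum \<phi> p 0 = 0"
  and weight_0 [simp]: "weight \<phi> p 0 = 1"
  by (simp_all add: partial_sum_def weight_def)

lemma partial_sum_Suc:
  "partial_sum \<phi> p (Suc n) =
     partial_sum \<phi> p n + weight \<phi> p n * real (perron_r \<phi> p n) / real (p (Suc n))"
  by (simp add: partial_sum_def perron_term_eq_weight)

lemma weight_Suc:
  "weight \<phi> p (Suc n) =
     weight \<phi> p n * real (perron_r \<phi> p n) / ((real (p (Suc n)) - 1) * real (p (Suc n)))"
  by (simp add: weight_def)

lemma perron_r_cong:
  assumes "\<And>i. 1 \<le> i \<Longrightarrow> i \<le> n \<Longrightarrow> p i = q i"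
  shows "perron_r \<phi> p n = perron_r \<phi> q n"
proof -
  have "map p [1..<Suc n] = map q [1..<Suc n]"
    by (rule map_cong) (auto intro: assms)
  then show ?thesis
    by (simp only: perron_r_def)
qed

lemma partial_sum_weight_cong:
  assumes "\<And>i. 1 \<le> i \<Longrightarrow> i \<le> n \<Longrightarrow> p i = q i"
  shows "partial_sum \<phi> p n = partial_sum \<phi> q n \<and> weight \<phi> p n = weight \<phi> q n"
  using assms
proof (induction n)
  case (Suc n)
  moreover have "perron_r \<phi> p n = perron_r \<phi> q n"
    using Suc.prems by (intro perron_r_cong) simp
  ultimately show ?case
    by (simp add: partial_sum_Suc weight_Suc)
qed simp

section \<open>The enclosure of a represented number\<close>

lemma perron_r_pos:
  assumes "perron_functions \<phi>" "\<And>i. 1 \<le> i \<Longrightarrow> i \<le> n \<Longrightarrow> 1 \<le> p i"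
  shows "perron_r \<phi> p n \<ge> 1"
proof -
  have "length (map p [1..<Suc n]) = n \<and> (\<forall>d\<in>set (map p [1..<Suc n]). 1 \<le> d)"
    using assms(2) by auto
  then show ?thesis
    using assms(1) unfolding perron_functions_def perron_r_def by blast
qed

lemma digit_bounds:
  assumes "perron_functions \<phi>" "admissible_digits \<phi> p"
  shows "real (perron_r \<phi> p n) \<ge> 1" "real (p (Suc n)) \<ge> real (perron_r \<phi> p n) + 1"
proof -
  have "1 \<le> p i" if "1 \<le> i" for i
    using assms(2) that unfolding admissible_digits_def by (meson le_add2 order_trans)
  then show "real (perron_r \<phi> p n) \<ge> 1"
    using perron_r_pos[OF assms(1), of n p] by simp
  have "p (Suc n) \<ge> perron_r \<phi> p n + 1"
    using assms(2) unfolding admissible_digits_def by (metis diff_Suc_1 le_add1 plus_1_eq_Suc)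
  then show "real (p (Suc n)) \<ge> real (perron_r \<phi> p n) + 1"
    by linarith
qed

lemma weight_bounds:
  assumes "perron_functions \<phi>" "admissible_digits \<phi> p"
  shows "0 < weight \<phi> p n \<and> weight \<phi> p n \<le> (1 / 2) ^ n"
proof (induction n)
  case (Suc n)
  define r where "r = real (perron_r \<phi> p n)"
  define d where "d = real (p (Suc n))"
  have r: "r \<ge> 1" and d: "d \<ge> r + 1"
    using digit_bounds[OF assms] by (auto simp: r_def d_def)
  have eq: "weight \<phi> p (Suc n) = weight \<phi> p n * (r / ((d - 1) * d))"
    by (simp add: weight_Suc r_def d_def)
  have "r * 2 \<le> (d - 1) * d"
    using r d by (intro mult_mono) auto
  then have "r / ((d - 1) * d) \<le> 1 / 2"
    using r d by (simp add: divide_simps)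
  moreover have "0 < r / ((d - 1) * d)"
    using r d by simp
  ultimately have "weight \<phi> p n * (r / ((d - 1) * d)) \<le> (1 / 2) ^ n * (1 / 2)"
    using Suc by (intro mult_mono) auto
  moreover have "0 < weight \<phi> p n * (r / ((d - 1) * d))"
    using Suc \<open>0 < r / ((d - 1) * d)\<close> by (intro mult_pos_pos) auto
  ultimately show ?case
    unfolding eq by (simp add: mult.commute)
qed simp

lemma weight_tendsto_0:
  assumes "perron_functions \<phi>" "admissible_digits \<phi> p"
  shows "weight \<phi> p \<longlonglongrightarrow> 0"
proof (rule tendsto_sandwich[where f = "\<lambda>_. 0" and h = "\<lambda>n. (1 / 2) ^ n"])
  show "(\<lambda>n. (1 / 2 :: real) ^ n) \<longlonglongrightarrow> 0"
    by (rule LIMSEQ_power_zero) simp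
qed (use weight_bounds[OF assms] in \<open>auto intro!: always_eventually less_imp_le\<close>)

lemma perron_term_pos:
  assumes "perron_functions \<phi>" "admissible_digits \<phi> p"
  shows "0 < perron_term \<phi> p n"
  unfolding perron_term_eq_weight
  using digit_bounds[OF assms, of n] weight_bounds[OF assms, of n] by simp

lemma strict_mono_partial_sum:
  assumes "perron_functions \<phi>" "admissible_digits \<phi> p"
  shows "strict_mono (partial_sum \<phi> p)"
  unfolding strict_mono_Suc_iff by (simp add: partial_sum_def perron_term_pos[OF assms])

text \<open>
  The telescoping identity \<open>1 / d + 1 / ((d - 1) d) = 1 / (d - 1)\<close>: the right end of an enclosing
  interval depends on its last digit \<open>d\<close> as the left end depends on the digit \<open>d - 1\<close>, so the
  intervals of neighbouring last digits share an endpoint.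
\<close>

lemma upper_end_Suc:
  assumes "perron_functions \<phi>" "admissible_digits \<phi> p"
  shows "partial_sum \<phi> p (Suc n) + weight \<phi> p (Suc n) =
     partial_sum \<phi> p n + weight \<phi> p n * real (perron_r \<phi> p n) / (real (p (Suc n)) - 1)"
proof -
  have "c / d + c / ((d - 1) * d) = c / (d - 1)" if "d > 1" for c d :: real
    using that by (simp add: divide_simps) (simp add: algebra_simps)
  moreover have "real (p (Suc n)) > 1"
    using digit_bounds[OF assms, of n] by linarith
  ultimately show ?thesis
    by (simp add: partial_sum_Suc weight_Suc)
qed

lemma decseq_upper_end:
  assumes "perron_functions \<phi>" "admissible_digits \<phi> p"
  shows "decseq (\<lambda>n. partial_sum \<phi> p n + weight \<phi> p n)"
proof (rule decseq_SucI)
  fix n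
  have "real (perron_r \<phi> p n) / (real (p (Suc n)) - 1) \<le> 1"
    using digit_bounds[OF assms, of n] by simp
  then have "weight \<phi> p n * (real (perron_r \<phi> p n) / (real (p (Suc n)) - 1)) \<le> weight \<phi> p n"
    using weight_bounds[OF assms, of n] by (intro mult_left_le) auto
  then show "partial_sum \<phi> p (Suc n) + weight \<phi> p (Suc n) \<le> partial_sum \<phi> p n + weight \<phi> p n"
    unfolding upper_end_Suc[OF assms] by simp
qed

text \<open>
  Both ends of the enclosing intervals move monotonically and their distance tends to \<open>0\<close>, so
  convergence of the series can be replaced by inequalities that involve finitely many digits each.
\<close>

lemma is_P_representation_iff_enclosed:
  assumes "perron_functions \<phi>"
  shows "is_P_representation \<phi> x p \<longleftrightarrow> admissible_digits \<phi> p \<and>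
     (\<forall>n. partial_sum \<phi> p n < x \<and> x \<le> partial_sum \<phi> p n + weight \<phi> p n)"
proof (cases "admissible_digits \<phi> p")
  case True
  note W = weight_tendsto_0[OF assms True]
  have sums: "perron_term \<phi> p sums x \<longleftrightarrow> partial_sum \<phi> p \<longlonglongrightarrow> x"
    by (simp add: sums_def partial_sum_def[abs_def])
  have "partial_sum \<phi> p n < x \<and> x \<le> partial_sum \<phi> p n + weight \<phi> p n"
    if lim: "partial_sum \<phi> p \<longlonglongrightarrow> x" for n
  proof
    have "partial_sum \<phi> p n < partial_sum \<phi> p (Suc n)"
      using strict_mono_partial_sum[OF assms True] by (simp add: strict_mono_def)
    also have "\<dots> \<le> x"
      by (rule incseq_le[OF strict_mono_mono[OF strict_mono_partial_sum[OF assms True]] lim])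
    finally show "partial_sum \<phi> p n < x" .
    have "(\<lambda>n. partial_sum \<phi> p n + weight \<phi> p n) \<longlonglongrightarrow> x"
      using tendsto_add[OF lim W] by simp
    then show "x \<le> partial_sum \<phi> p n + weight \<phi> p n"
      by (rule decseq_ge[OF decseq_upper_end[OF assms True]])
  qed
  moreover have "partial_sum \<phi> p \<longlonglongrightarrow> x"
    if enclosed: "\<forall>n. partial_sum \<phi> p n < x \<and> x \<le> partial_sum \<phi> p n + weight \<phi> p n"
  proof (rule tendsto_sandwich[where f = "\<lambda>n. x - weight \<phi> p n" and h = "\<lambda>_. x"])
    show "(\<lambda>n. x - weight \<phi> p n) \<longlonglongrightarrow> x"
      using tendsto_diff[OF tendsto_const W] by simp
    show "\<forall>\<^sub>F n in sequentially. x - weight \<phi> p n \<le> partial_sum \<phi> p n"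
      using enclosed by (simp add: diff_le_eq)
    show "\<forall>\<^sub>F n in sequentially. partial_sum \<phi> p n \<le> x"
      using enclosed by (simp add: less_imp_le)
  qed simp
  ultimately show ?thesis
    unfolding is_P_representation_iff sums using True by blast
qed (simp add: is_P_representation_iff)

section \<open>Uniqueness of the digits\<close>

text \<open>
  Expansions are ordered by their first differing digit, larger digits giving smaller numbers:
  the interval belonging to the digit \<open>q j \<ge> p j + 1\<close> ends no later than the one belonging to
  \<open>p j\<close> begins.
\<close>

lemma larger_digit_le_partial_sum:
  assumes "perron_functions \<phi>" "is_P_representation \<phi> x p" "is_P_representation \<phi> y q"
    and "1 \<le> j" "\<And>i. 1 \<le> i \<Longrightarrow> i < j \<Longrightarrow> p i = q i" "p j < q j"
  shows "y \<le> partial_sum \<phi> p j"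
proof -
  obtain n where j: "j = Suc n"
    using assms(4) by (cases j) auto
  have adm: "admissible_digits \<phi> p" "admissible_digits \<phi> q"
    using assms(2,3) by (auto simp: is_P_representation_iff)
  have agree: "p i = q i" if "1 \<le> i" "i \<le> n" for i
    using assms(5) that j by simp
  have same: "perron_r \<phi> p n = perron_r \<phi> q n" "partial_sum \<phi> p n = partial_sum \<phi> q n"
    "weight \<phi> p n = weight \<phi> q n"
    using perron_r_cong[of n p q, OF agree] partial_sum_weight_cong[of n p q, OF agree] by auto
  have "y \<le> partial_sum \<phi> q j + weight \<phi> q j"
    using assms(3) by (simp add: is_P_representation_iff_enclosed[OF assms(1)])
  also have "\<dots> = partial_sum \<phi> p n + weight \<phi> p n * real (perron_r \<phi> p n) / (real (q j) - 1)"
    unfolding j upper_end_Suc[OF assms(1) adm(2)] same ..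
  also have "\<dots> \<le> partial_sum \<phi> p n + weight \<phi> p n * real (perron_r \<phi> p n) / real (p j)"
    using assms(6) weight_bounds[OF assms(1) adm(1), of n] digit_bounds[OF assms(1) adm(1), of n] j
    by (intro add_left_mono divide_left_mono mult_nonneg_nonneg mult_pos_pos) auto
  also have "\<dots> = partial_sum \<phi> p j"
    by (simp add: j partial_sum_Suc)
  finally show ?thesis .
qed

text \<open>
  At a first disagreement \<open>j \<le> m\<close>, a larger digit of \<open>y\<close> would push \<open>y\<close> below \<open>S\<^sub>j(x) \<le> S\<^sub>m(x)\<close>,
  and a larger digit of \<open>x\<close> would push \<open>x\<close> below \<open>y\<close>. The case \<open>x = y\<close> is the uniqueness of
  the digits.
\<close>

lemma digits_agree_if_between:
  assumes "perron_functions \<phi>" "is_P_representation \<phi> x p" "is_P_representation \<phi> y q"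
    and "partial_sum \<phi> p m < y" "y \<le> x" "1 \<le> i" "i \<le> m"
  shows "p i = q i"
  using assms(6,7)
proof (induction i rule: less_induct)
  case (less j)
  have agree: "p i = q i" if "1 \<le> i" "i < j" for i
    using less that by simp
  have "\<not> p j < q j"
  proof
    assume "p j < q j"
    then have "y \<le> partial_sum \<phi> p j"
      using larger_digit_le_partial_sum[OF assms(1-3)] less.prems agree by blast
    also have "\<dots> \<le> partial_sum \<phi> p m"
      using strict_mono_partial_sum[OF assms(1)] assms(2) less.prems
      by (meson is_P_representation_iff strict_mono_less_eq)
    finally show False
      using assms(4) by simp
  qed
  moreover have "\<not> q j < p j"
  proof
    assume "q j < p j"
    then have "x \<le> partial_sum \<phi> q j"
      using larger_digit_le_partial_sum[OF assms(1,3,2)] less.prems agree by metis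
    also have "\<dots> < y"
      using assms(3) by (simp add: is_P_representation_iff_enclosed[OF assms(1)])
    finally show False
      using assms(5) by simp
  qed
  ultimately show ?case
    by simp
qed

lemma P_digit_eq:
  assumes "perron_functions \<phi>" "is_P_representation \<phi> x p" "1 \<le> n"
  shows "P_digit \<phi> x n = p n"
  unfolding P_digit_def
proof (rule the_equality)
  fix d
  assume "\<exists>q. is_P_representation \<phi> x q \<and> q n = d"
  then obtain q where q: "is_P_representation \<phi> x q" "q n = d"
    by blast
  have "partial_sum \<phi> p n < x"
    using assms(2) by (simp add: is_P_representation_iff_enclosed[OF assms(1)])
  then show "d = p n"
    using digits_agree_if_between[OF assms(1,2) q(1), of n n] assms(3) q(2) by simp
qed (use assms(2) in blast)

section \<open>Existence of the expansion\<close>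

text \<open>
  The state after \<open>n\<close> steps consists of the digits chosen so far and the remainder
  \<open>t = (x - S\<^sub>n) / W\<^sub>n\<close>, which stays in \<open>(0, 1]\<close>. The next digit is the only \<open>d\<close> with
  \<open>r / d < t \<le> r / (d - 1)\<close>.
\<close>

primrec greedy :: "(nat \<Rightarrow> nat list \<Rightarrow> nat) \<Rightarrow> real \<Rightarrow> nat \<Rightarrow> nat list \<times> real" where
  "greedy \<phi> x 0 = ([], x)"
| "greedy \<phi> x (Suc n) =
     (let c = fst (greedy \<phi> x n); t = snd (greedy \<phi> x n); r = real (\<phi> n c); d = nat \<lfloor>r / t\<rfloor> + 1
      in (c @ [d], (t - r / real d) * ((real d - 1) * real d) / r))"

definition greedy_digit :: "(nat \<Rightarrow> nat list \<Rightarrow> nat) \<Rightarrow> real \<Rightarrow> nat \<Rightarrow> nat" where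
  "greedy_digit \<phi> x n = last (fst (greedy \<phi> x n))"

lemma fst_greedy: "fst (greedy \<phi> x n) = map (greedy_digit \<phi> x) [1..<Suc n]"
proof (induction n)
  case (Suc n)
  have "fst (greedy \<phi> x (Suc n)) = fst (greedy \<phi> x n) @ [greedy_digit \<phi> x (Suc n)]"
    by (simp add: Let_def greedy_digit_def)
  then show ?case
    by (simp add: Suc.IH del: greedy.simps)
qed simp

text \<open>
  One step of the algorithm, with \<open>r / t\<close> in \<open>[d - 1, d)\<close> by the choice of \<open>d\<close>: the digit meets
  its constraint because \<open>r / t \<ge> r\<close>, and the remainder stays in \<open>(0, 1]\<close> because the interval
  \<open>(r / d, r / (d - 1)]\<close> has length \<open>r / ((d - 1) d)\<close>.
\<close>

lemma greedy_step:
  fixes t :: real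
  assumes "1 \<le> r" "0 < t" "t \<le> 1" and d: "d = nat \<lfloor>real r / t\<rfloor> + 1"
  shows "r + 1 \<le> d"
    and "0 < (t - real r / real d) * ((real d - 1) * real d) / real r"
    and "(t - real r / real d) * ((real d - 1) * real d) / real r \<le> 1"
proof -
  have "real r * t \<le> real r"
    using assms(1-3) by (simp add: mult_left_le)
  then have "real r \<le> real r / t"
    using assms(2) by (simp add: pos_le_divide_eq)
  then have "int r \<le> \<lfloor>real r / t\<rfloor>"
    by (simp add: le_floor_iff)
  then show le: "r + 1 \<le> d"
    using d by linarith
  have d1: "real d > 1"
    using le assms(1) by linarith
  have fl: "real d = real_of_int \<lfloor>real r / t\<rfloor> + 1"
    using d \<open>int r \<le> \<lfloor>real r / t\<rfloor>\<close> by simp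
  have "real r / t < real d" "real d - 1 \<le> real r / t"
    unfolding fl by linarith+
  then have lo: "real r < t * real d" and hi: "(real d - 1) * t \<le> real r"
    using assms(2) by (simp_all add: pos_divide_less_eq pos_le_divide_eq mult.commute)
  have "(t - real r / real d) * real d = t * real d - real r"
    using d1 by (simp add: left_diff_distrib)
  then have eq: "(t - real r / real d) * ((real d - 1) * real d) = (t * real d - real r) * (real d - 1)"
    by (metis mult.assoc mult.commute)
  have "0 < (t * real d - real r) * (real d - 1)"
    using lo d1 by (intro mult_pos_pos) auto
  then show "0 < (t - real r / real d) * ((real d - 1) * real d) / real r"
    unfolding eq using assms(1) by (intro divide_pos_pos) auto
  have "(real d - 1) * t * real d \<le> real r * real d"
    using hi by (intro mult_right_mono) auto
  then have "(t * real d - real r) * (real d - 1) \<le> real r"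
    by (simp add: algebra_simps)
  then show "(t - real r / real d) * ((real d - 1) * real d) / real r \<le> 1"
    unfolding eq using assms(1) by (intro divide_le_eq_1_pos[THEN iffD2]) auto
qed

lemma greedy_invariant:
  assumes "perron_functions \<phi>" "0 < x" "x \<le> 1"
  defines "p \<equiv> greedy_digit \<phi> x"
  shows "(\<forall>i. 1 \<le> i \<and> i \<le> n \<longrightarrow> p i \<ge> perron_r \<phi> p (i - 1) + 1) \<and>
     0 < snd (greedy \<phi> x n) \<and> snd (greedy \<phi> x n) \<le> 1 \<and>
     x = partial_sum \<phi> p n + weight \<phi> p n * snd (greedy \<phi> x n)"
proof (induction n)
  case (Suc n)
  define t where "t = snd (greedy \<phi> x n)"
  define r where "r = perron_r \<phi> p n"
  have fst: "fst (greedy \<phi> x n) = map p [1..<Suc n]"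
    unfolding p_def by (rule fst_greedy)
  have r_eq: "\<phi> n (fst (greedy \<phi> x n)) = r"
    unfolding fst r_def perron_r_def ..
  have d: "p (Suc n) = nat \<lfloor>real r / t\<rfloor> + 1"
    unfolding p_def greedy_digit_def by (simp add: Let_def r_eq t_def)
  have t': "snd (greedy \<phi> x (Suc n)) =
      (t - real r / real (p (Suc n))) * ((real (p (Suc n)) - 1) * real (p (Suc n))) / real r"
    by (simp add: Let_def r_eq d t_def)
  have "1 \<le> p i" if "1 \<le> i" "i \<le> n" for i
    using Suc.IH that by (meson le_add2 order_trans)
  then have r1: "1 \<le> r"
    unfolding r_def by (rule perron_r_pos[OF assms(1)])
  note step = greedy_step[OF r1 _ _ d, folded t']
  have t: "0 < t" "t \<le> 1" and x: "x = partial_sum \<phi> p n + weight \<phi> p n * t"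
    using Suc.IH by (auto simp: t_def)
  have "x = partial_sum \<phi> p (Suc n) + weight \<phi> p (Suc n) * snd (greedy \<phi> x (Suc n))"
  proof -
    have "real (p (Suc n)) > 1" "real r > 0"
      using step(1)[OF t] r1 by linarith+
    then have "w * real r / real (p (Suc n)) + w * real r / ((real (p (Suc n)) - 1) * real (p (Suc n)))
        * snd (greedy \<phi> x (Suc n)) = w * t" for w
      unfolding t' by (simp add: divide_simps) (simp add: algebra_simps)
    then show ?thesis
      using x by (simp add: partial_sum_Suc weight_Suc flip: r_def)
  qed
  moreover have "\<forall>i. 1 \<le> i \<and> i \<le> Suc n \<longrightarrow> p i \<ge> perron_r \<phi> p (i - 1) + 1"
    using Suc.IH step(1)[OF t] unfolding le_Suc_eq by (auto simp: r_def)
  ultimately show ?case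
    using step(2,3)[OF t] by blast
qed (use assms(2,3) in auto)

lemma P_representation_exists:
  assumes "perron_functions \<phi>" "0 < x" "x \<le> 1"
  shows "\<exists>p. is_P_representation \<phi> x p"
proof
  let ?p = "greedy_digit \<phi> x"
  note inv = greedy_invariant[OF assms]
  have adm: "admissible_digits \<phi> ?p"
    unfolding admissible_digits_def using inv by blast
  have "partial_sum \<phi> ?p n < x \<and> x \<le> partial_sum \<phi> ?p n + weight \<phi> ?p n" for n
  proof -
    define t where "t = snd (greedy \<phi> x n)"
    have t: "0 < t" "t \<le> 1" and x: "x = partial_sum \<phi> ?p n + weight \<phi> ?p n * t"
      using inv[of n] by (auto simp: t_def)
    have "0 < weight \<phi> ?p n"
      using weight_bounds[OF assms(1) adm] by simp
    then have "0 < weight \<phi> ?p n * t" "weight \<phi> ?p n * t \<le> weight \<phi> ?p n"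
      using t by (simp_all add: mult_left_le)
    then show ?thesis
      using x by linarith
  qed
  then show "is_P_representation \<phi> x ?p"
    using adm by (simp add: is_P_representation_iff_enclosed[OF assms(1)])
qed

section \<open>Convergence from the left and agreement of digits\<close>

lemma dist_le_if_digits_agree:
  assumes "perron_functions \<phi>" "is_P_representation \<phi> x p" "is_P_representation \<phi> y q"
    and "\<And>i. 1 \<le> i \<Longrightarrow> i \<le> m \<Longrightarrow> p i = q i"
  shows "\<bar>x - y\<bar> \<le> weight \<phi> p m"
proof -
  have "partial_sum \<phi> p m = partial_sum \<phi> q m" "weight \<phi> p m = weight \<phi> q m"
    using partial_sum_weight_cong[of m p q, OF assms(4)] by auto
  moreover have "partial_sum \<phi> p m < x" "x \<le> partial_sum \<phi> p m + weight \<phi> p m"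
    "partial_sum \<phi> q m < y" "y \<le> partial_sum \<phi> q m + weight \<phi> q m"
    using assms(2,3) by (auto simp: is_P_representation_iff_enclosed[OF assms(1)])
  ultimately show ?thesis
    by linarith
qed

theorem proposition3:
  fixes \<phi> :: "nat \<Rightarrow> nat list \<Rightarrow> nat"
    and x\<^sub>0 :: real
    and x :: "nat \<Rightarrow> real"
    and k :: "nat \<Rightarrow> nat"
  assumes "perron_functions \<phi>"
    and "0 < x\<^sub>0" and "x\<^sub>0 \<le> 1"
    and "\<exists>c. admissible_base \<phi> c \<and> x\<^sub>0 = Sup (P_cylinder \<phi> c)"
    and "\<And>n. 1 \<le> n \<Longrightarrow> 0 < x n \<and> x n < x\<^sub>0"
    and "\<And>n. 1 \<le> n \<Longrightarrow> k n = (LEAST j. 1 \<le> j \<and> P_digit \<phi> (x n) j \<noteq> P_digit \<phi> x\<^sub>0 j)"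
  shows "x \<longlonglongrightarrow> x\<^sub>0 \<longleftrightarrow> filterlim k at_top sequentially"
proof -
  note \<phi> = assms(1)
  obtain p where p: "is_P_representation \<phi> x\<^sub>0 p"
    using P_representation_exists[OF \<phi> assms(2,3)] by blast
  have "\<exists>q. is_P_representation \<phi> (x n) q" if "1 \<le> n" for n
    using P_representation_exists[OF \<phi>, of "x n"] assms(5)[OF that] assms(3) by auto
  then obtain q where q: "is_P_representation \<phi> (x n) (q n)" if "1 \<le> n" for n
    by metis
  have W0: "weight \<phi> p \<longlonglongrightarrow> 0"
    using weight_tendsto_0[OF \<phi>] p by (simp add: is_P_representation_iff)
  have k: "k n = (LEAST j. 1 \<le> j \<and> q n j \<noteq> p j)" if "1 \<le> n" for n
  proof -
    have "(1 \<le> j \<and> P_digit \<phi> (x n) j \<noteq> P_digit \<phi> x\<^sub>0 j) \<longleftrightarrow> (1 \<le> j \<and> q n j \<noteq> p j)" for j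
      using P_digit_eq[OF \<phi> p] P_digit_eq[OF \<phi> q[OF that]] by auto
    then show ?thesis
      using assms(6)[OF that] by simp
  qed
  have agree_below: "p i = q n i" if "1 \<le> n" "1 \<le> i" "i < k n" for n i
    using not_less_Least[of i "\<lambda>j. 1 \<le> j \<and> q n j \<noteq> p j"] that k[OF that(1)] by auto
  \<comment> \<open>The digits determine the number, so the minimum defining \<open>k n\<close> is over a nonempty set.\<close>
  have differ: "1 \<le> k n \<and> q n (k n) \<noteq> p (k n)" if "1 \<le> n" for n
  proof -
    have "\<exists>j. 1 \<le> j \<and> q n j \<noteq> p j"
    proof (rule ccontr)
      assume "\<nexists>j. 1 \<le> j \<and> q n j \<noteq> p j"
      then have "\<bar>x\<^sub>0 - x n\<bar> \<le> weight \<phi> p m" for m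
        by (intro dist_le_if_digits_agree[OF \<phi> p q[OF that]]) auto
      then have "\<bar>x\<^sub>0 - x n\<bar> \<le> 0"
        using W0 by (meson LIMSEQ_le_const)
      then show False
        using assms(5)[OF that] by simp
    qed
    then show ?thesis
      unfolding k[OF that] by (rule LeastI_ex)
  qed
  show ?thesis
  proof
    assume lim: "x \<longlonglongrightarrow> x\<^sub>0"
    show "filterlim k at_top sequentially"
      unfolding filterlim_at_top
    proof
      fix m
      have "partial_sum \<phi> p m < x\<^sub>0"
        using p by (simp add: is_P_representation_iff_enclosed[OF \<phi>])
      then have "\<forall>\<^sub>F n in sequentially. partial_sum \<phi> p m < x n"
        by (rule order_tendstoD(1)[OF lim])
      then show "\<forall>\<^sub>F n in sequentially. m \<le> k n"
        using eventually_ge_at_top[of 1]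
      proof eventually_elim
        case (elim n)
        show ?case
        proof (rule ccontr)
          assume "\<not> m \<le> k n"
          then have "p (k n) = q n (k n)"
            using digits_agree_if_between[OF \<phi> p q[OF elim(2)] elim(1)] assms(5)[OF elim(2)]
              differ[OF elim(2)] by simp
          then show False
            using differ[OF elim(2)] by simp
        qed
      qed
    qed
  next
    assume lim: "filterlim k at_top sequentially"
    \<comment> \<open>At the place \<open>k n\<close> itself the digits differ, so only \<open>k n - 1\<close> digits are shared.\<close>
    have "filterlim (\<lambda>n. k n - 1) at_top sequentially"
      using filterlim_compose[OF filterlim_minus_const_nat_at_top lim] .
    then have "(\<lambda>n. weight \<phi> p (k n - 1)) \<longlonglongrightarrow> 0"
      by (rule filterlim_compose[OF W0])
    moreover have "\<forall>\<^sub>F n in sequentially. norm (x n - x\<^sub>0) \<le> norm (weight \<phi> p (k n - 1)) * 1"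
      using eventually_ge_at_top[of 1]
    proof eventually_elim
      case (elim n)
      have "\<bar>x\<^sub>0 - x n\<bar> \<le> weight \<phi> p (k n - 1)"
        using agree_below[OF elim] by (intro dist_le_if_digits_agree[OF \<phi> p q[OF elim]]) simp
      then show ?case
        by (simp add: abs_minus_commute)
    qed
    ultimately have "(\<lambda>n. x n - x\<^sub>0) \<longlonglongrightarrow> 0"
      by (rule tendsto_0_le)
    then show "x \<longlonglongrightarrow> x\<^sub>0"
      by (simp add: LIM_zero_iff)
  qed
qed

end
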